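(* Let $n\in\mathbb N$ and let $A,B\in C(\mathbb R,\mathbb R^{n\times n})$. Let $X(t)$ be the fundamental matrix solution of $x'=A(t)x$ with $X(0)=I$, and put $P(t)=X^{-1}(t)B(t)X(t)$. Suppose that $$\int_0^\infty \|P(t)\|\,dt<\infty .$$ Let $\Psi(t)$ be a solution of the matrix differential equation $\Psi'=P(t)(\Psi+I)$ satisfying $\Psi(t)\to 0$ as $t\to\infty$, and suppose that $$\lim_{t\to\infty}X(t)\Psi(t)=0 .$$ Then the systems $y'=[A(t)+B(t)]y$ and $x'=A(t)x$ are asymptotically equivalent.
   Context: $\|\cdot\|$ is the Euclidean norm on $\mathbb R^n$ (and a corresponding matrix norm); $C(\mathbb X,\mathbb Y)$ is the set of continuous functions from $\mathbb X$ to $\mathbb Y$. Under the integrability condition on $P$, a solution $\Psi$ of $\Psi'=P(t)(\Psi+I)$ with $\Psi(t)\to0$ as $t\to\infty$ exists (a known lemma of Ráb). Two systems are called asymptotically equivalent if there is a homeomorphism $x\leftrightarrow y$ between their sets of solutions such that corresponding solutions satisfy $x(t)-y(t)\to0$ as $t\to\infty$. Here the set of solutions is topologized by identifying a solution with its value at a fixed initial time. *)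

theory Defs
  imports "HOL-Analysis.Analysis"
begin

definition solutions :: "(real \<Rightarrow> real^'n^'n) \<Rightarrow> (real \<Rightarrow> real^'n) set" where
  "solutions F = {x. \<forall>t. (x has_vector_derivative F t *v x t) (at t)}"

text \<open>A solution is identified with its value at the initial time \<open>t0\<close>: the topology is
  the initial one for evaluation at \<open>t0\<close>. For continuous \<open>F\<close> this evaluation is a bijection
  onto the whole space and the topology does not depend on \<open>t0\<close>.\<close>

definition solution_topology ::
    "real \<Rightarrow> (real \<Rightarrow> real^'n^'n) \<Rightarrow> (real \<Rightarrow> real^'n) topology" where
  "solution_topology t0 F = pullback_topology (solutions F) (\<lambda>x. x t0) euclidean"

definition asymptotically_equivalent ::
    "real \<Rightarrow> (real \<Rightarrow> real^'n^'n) \<Rightarrow> (real \<Rightarrow> real^'n^'n) \<Rightarrow> bool" where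
  "asymptotically_equivalent t0 F G \<longleftrightarrow>
    (\<exists>h. homeomorphic_map (solution_topology t0 F) (solution_topology t0 G) h \<and>
         (\<forall>y\<in>solutions F. ((\<lambda>t. h y t - y t) \<longlongrightarrow> 0) at_top))"

end

theory Submission
  imports Defs
begin

text \<open>
  Variation of constants turns \<open>\<Psi>\<close> into a matrix solution of the perturbed system. Put
  \<open>Y t = X t ** (\<Psi> t + mat 1)\<close>. The equation for \<open>\<Psi>\<close> and the choice
  \<open>P = X\<^sup>-\<^sup>1 B X\<close> give \<open>Y' = (A + B) Y\<close>, while
  \<open>Y t - X t = X t ** \<Psi> t\<close> tends to zero by hypothesis. So \<open>Y t *v c \<leftrightarrow> X t *v c\<close> is the
  required correspondence, as soon as every solution of either system has such a form with a
  unique \<open>c\<close>; on initial values the correspondence is then the invertible linear map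
  \<open>X t0 ** (Y t0)\<^sup>-\<^sup>1\<close>, hence a homeomorphism.

  Both points rest on uniqueness for linear systems with continuous coefficients
  (\<open>solution_unique\<close>). Uniqueness implies that a vector annihilated by a matrix solution at
  one time is annihilated at all times. For \<open>X\<close> evaluation at time \<open>0\<close> then shows that the vector
  is zero. For \<open>Y\<close> the limit at infinity takes the place of time \<open>0\<close>: if \<open>Y t *v v\<close> vanishes
  for all \<open>t\<close>, so does \<open>(\<Psi> t + mat 1) *v v\<close> because \<open>X t\<close> is invertible, and the limit of the
  latter is \<open>v\<close>.
\<close>

section \<open>Matrix products\<close>

lemma bounded_bilinear_matrix_vector_mult:
  "bounded_bilinear ((*v) :: real^'n^'m \<Rightarrow> real^'n \<Rightarrow> real^'m)"
  unfolding bilinear_conv_bounded_bilinear[symmetric] bilinear_def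
  by (auto intro!: linearI simp: algebra_simps matrix_vector_mult_add_rdistrib
      scaleR_matrix_vector_assoc)

lemma bounded_bilinear_matrix_matrix_mult:
  "bounded_bilinear ((**) :: real^'n^'m \<Rightarrow> real^'k^'n \<Rightarrow> real^'k^'m)"
  unfolding bilinear_conv_bounded_bilinear[symmetric] bilinear_def
  by (auto intro!: linearI simp: vec_eq_iff matrix_matrix_mult_def sum.distrib algebra_simps
      sum_distrib_left)

lemma has_vector_derivative_matrix_vector_mult:
  fixes \<Phi> :: "real \<Rightarrow> real^'n^'m"
  assumes "(\<Phi> has_vector_derivative D) (at t)"
  shows "((\<lambda>t. \<Phi> t *v c) has_vector_derivative D *v c) (at t)"
  using bounded_bilinear.has_vector_derivative
    [OF bounded_bilinear_matrix_vector_mult assms has_vector_derivative_const[of c]]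
  by simp

lemma invertible_matrix_inv:
  fixes M :: "real^'n^'n"
  assumes "invertible M"
  shows "M ** matrix_inv M = mat 1" and "matrix_inv M ** M = mat 1"
  using someI_ex[OF assms[unfolded invertible_def]] unfolding matrix_inv_def by auto

lemma invertible_if_trivial_kernel:
  fixes M :: "real^'n^'n"
  assumes "\<And>v. M *v v = 0 \<Longrightarrow> v = 0"
  shows "invertible M"
  using assms matrix_left_invertible_ker invertible_left_inverse by blast

section \<open>Uniqueness for linear systems\<close>

text \<open>
  Gronwall's argument, in differential form: on an interval where the coefficient matrix is bounded
  by \<open>L\<close>, the squared norm \<open>u\<close> of a solution satisfies \<open>\<bar>u'\<bar> \<le> 2 L u\<close>. Hence \<open>u\<close> times
  \<open>exp (- 2 L t)\<close> decreases and \<open>u\<close> times \<open>exp (2 L t)\<close> increases, so that a zero of \<open>u\<close> spreads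
  forwards and backwards in time.
\<close>
lemma solution_zero_if_zero_once:
  fixes F :: "real \<Rightarrow> real^'n^'n"
  assumes F: "continuous_on UNIV F" and x: "x \<in> solutions F" and s: "x s = 0"
  shows "x t = 0"
proof -
  define a b where "a = min s t" and "b = max s t"
  obtain K where K: "K > 0" "\<And>(M::real^'n^'n) v. norm (M *v v) \<le> norm M * norm v * K"
    using bounded_bilinear.pos_bounded[OF bounded_bilinear_matrix_vector_mult] by blast
  have "bounded (F ` {a..b})"
    by (intro compact_imp_bounded compact_continuous_image continuous_on_subset[OF F]) auto
  then obtain C where C: "\<And>r. r \<in> {a..b} \<Longrightarrow> norm (F r) \<le> C"
    unfolding bounded_iff by blast
  define L where "L = C * K"
  define u where "u = (\<lambda>r. x r \<bullet> x r)"
  define u' where "u' = (\<lambda>r. 2 * (x r \<bullet> (F r *v x r)))"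
  have u: "(u has_real_derivative u' r) (at r)" for r
  proof -
    have "(x has_vector_derivative F r *v x r) (at r)"
      using x by (auto simp: solutions_def)
    from bounded_bilinear.has_vector_derivative[OF bounded_bilinear_inner this this]
    show ?thesis
      by (simp add: u_def u'_def has_real_derivative_iff_has_vector_derivative inner_commute)
  qed
  have bound: "\<bar>u' r\<bar> \<le> 2 * L * u r" if "r \<in> {a..b}" for r
  proof -
    have "\<bar>x r \<bullet> (F r *v x r)\<bar> \<le> norm (x r) * norm (F r *v x r)"
      by (rule Cauchy_Schwarz_ineq2)
    also have "\<dots> \<le> norm (x r) * (norm (F r) * norm (x r) * K)"
      by (intro mult_left_mono K) auto
    also have "\<dots> \<le> norm (x r) * (C * norm (x r) * K)"
      using K(1) C[OF that] by (intro mult_left_mono mult_right_mono) auto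
    also have "\<dots> = L * u r"
      by (simp add: u_def L_def dot_square_norm power2_eq_square)
    finally show ?thesis by (simp add: u'_def abs_mult)
  qed
  have u_ge: "u r \<ge> 0" for r by (simp add: u_def)
  have deriv: "((\<lambda>r. u r * exp (k * r)) has_real_derivative (u' r + k * u r) * exp (k * r)) (at r)"
    for k r
    by (auto intro!: derivative_eq_intros u simp: algebra_simps)
  have "u t = 0"
  proof (cases "s \<le> t")
    case True
    then have ab: "a = s" "b = t" by (auto simp: a_def b_def)
    have "u t * exp (- 2 * L * t) \<le> u s * exp (- 2 * L * s)"
    proof (rule DERIV_nonpos_imp_nonincreasing[OF True, where f = "\<lambda>r. u r * exp (- 2 * L * r)"])
      fix r assume "s \<le> r" "r \<le> t"
      then have "u' r + - 2 * L * u r \<le> 0" using bound[of r] ab by auto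
      then show "\<exists>y. ((\<lambda>r. u r * exp (- 2 * L * r)) has_real_derivative y) (at r) \<and> y \<le> 0"
        using deriv[of "- 2 * L" r] by (meson exp_ge_zero mult_nonpos_nonneg)
    qed
    then have "u t * exp (- 2 * L * t) \<le> 0" by (simp add: u_def s)
    then show ?thesis using u_ge[of t] by (simp add: mult_le_0_iff)
  next
    case False
    then have ab: "a = t" "b = s" by (auto simp: a_def b_def)
    have "u t * exp (2 * L * t) \<le> u s * exp (2 * L * s)"
    proof (rule DERIV_nonneg_imp_nondecreasing[where f = "\<lambda>r. u r * exp (2 * L * r)"])
      fix r assume "t \<le> r" "r \<le> s"
      then have "u' r + 2 * L * u r \<ge> 0" using bound[of r] ab by auto
      then show "\<exists>y. ((\<lambda>r. u r * exp (2 * L * r)) has_real_derivative y) (at r) \<and> y \<ge> 0"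
        using deriv[of "2 * L" r] by (meson exp_ge_zero mult_nonneg_nonneg)
    qed (use False in simp)
    then have "u t * exp (2 * L * t) \<le> 0" by (simp add: u_def s)
    then show ?thesis using u_ge[of t] by (simp add: mult_le_0_iff)
  qed
  then show ?thesis by (simp add: u_def)
qed

lemma solutions_diff:
  assumes "x \<in> solutions F" and "y \<in> solutions F"
  shows "(\<lambda>t. x t - y t) \<in> solutions F"
  using assms
  by (auto simp: solutions_def matrix_vector_mult_diff_distrib intro!: has_vector_derivative_diff)

lemma solution_unique:
  fixes F :: "real \<Rightarrow> real^'n^'n"
  assumes "continuous_on UNIV F" and "x \<in> solutions F" and "y \<in> solutions F" and "x s = y s"
  shows "x = y"
  using solution_zero_if_zero_once[OF assms(1) solutions_diff[OF assms(2,3)], of s] assms(4)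
  by (simp add: fun_eq_iff)

section \<open>Fundamental matrices\<close>

lemma matrix_solution_mult_in_solutions:
  fixes F \<Phi> :: "real \<Rightarrow> real^'n^'n"
  assumes "\<And>t. (\<Phi> has_vector_derivative F t ** \<Phi> t) (at t)"
  shows "(\<lambda>t. \<Phi> t *v c) \<in> solutions F"
  using has_vector_derivative_matrix_vector_mult[OF assms]
  by (auto simp: solutions_def matrix_vector_mul_assoc)

text \<open>
  The kernel of a matrix solution does not depend on time, so it is enough to rule out vectors that
  are annihilated at every time. This lets the kernel be tested wherever it is most convenient, in
  particular in the limit.
\<close>
lemma matrix_solution_invertible:
  fixes F \<Phi> :: "real \<Rightarrow> real^'n^'n"
  assumes F: "continuous_on UNIV F"
    and \<Phi>: "\<And>t. (\<Phi> has_vector_derivative F t ** \<Phi> t) (at t)"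
    and ker: "\<And>v. (\<And>t. \<Phi> t *v v = 0) \<Longrightarrow> v = 0"
  shows "invertible (\<Phi> s)"
proof (rule invertible_if_trivial_kernel)
  fix v assume "\<Phi> s *v v = 0"
  then have "\<Phi> t *v v = 0" for t
    using solution_zero_if_zero_once[OF F matrix_solution_mult_in_solutions[OF \<Phi>]] by blast
  then show "v = 0" by (rule ker)
qed

lemma solution_eq_fundamental_matrix_mult:
  fixes F \<Phi> :: "real \<Rightarrow> real^'n^'n"
  assumes F: "continuous_on UNIV F"
    and \<Phi>: "\<And>t. (\<Phi> has_vector_derivative F t ** \<Phi> t) (at t)"
    and inv: "invertible (\<Phi> s)" and x: "x \<in> solutions F"
  shows "x = (\<lambda>t. \<Phi> t *v (matrix_inv (\<Phi> s) *v x s))"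
  by (rule solution_unique[OF F x matrix_solution_mult_in_solutions[OF \<Phi>], of s])
    (simp add: matrix_vector_mul_assoc invertible_matrix_inv[OF inv])

text \<open>
  The solution with the same coordinate vector \<open>c\<close> with respect to the other fundamental matrix,
  \<open>\<Phi> t *v c \<mapsto> \<Xi> t *v c\<close>; the vector \<open>c\<close> is recovered from the value of the solution at \<open>s\<close>.
\<close>
definition transfer ::
    "real \<Rightarrow> (real \<Rightarrow> real^'n^'n) \<Rightarrow> (real \<Rightarrow> real^'n^'n) \<Rightarrow> (real \<Rightarrow> real^'n) \<Rightarrow> real \<Rightarrow> real^'n"
  where "transfer s \<Phi> \<Xi> y = (\<lambda>t. \<Xi> t *v (matrix_inv (\<Phi> s) *v y s))"

lemma continuous_map_transfer:
  fixes F G \<Phi> \<Xi> :: "real \<Rightarrow> real^'n^'n"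
  assumes "\<And>t. (\<Xi> has_vector_derivative G t ** \<Xi> t) (at t)"
  shows "continuous_map (solution_topology s F) (solution_topology s G) (transfer s \<Phi> \<Xi>)"
  unfolding solution_topology_def
proof (rule continuous_map_pullback')
  have "continuous_map euclidean euclidean (\<lambda>v. \<Xi> s *v (matrix_inv (\<Phi> s) *v v))"
    by (auto simp: matrix_vector_mul_assoc intro!: linear_continuous_on)
  then show "continuous_map (pullback_topology (solutions F) (\<lambda>x. x s) euclidean) euclidean
      ((\<lambda>x. x s) \<circ> transfer s \<Phi> \<Xi>)"
    using continuous_map_pullback[where f = "\<lambda>x. x s" and A = "solutions F"]
    by (fastforce simp: o_def transfer_def simp del: continuous_map_iff_continuous2)
  show "topspace (pullback_topology (solutions F) (\<lambda>x. x s) euclidean)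
      \<subseteq> transfer s \<Phi> \<Xi> -` solutions G"
    using matrix_solution_mult_in_solutions[OF assms] by (auto simp: transfer_def)
qed

lemma transfer_transfer:
  fixes F \<Phi> :: "real \<Rightarrow> real^'n^'n"
  assumes "continuous_on UNIV F" and "\<And>t. (\<Phi> has_vector_derivative F t ** \<Phi> t) (at t)"
    and "invertible (\<Phi> s)" and "invertible (\<Xi> s)" and y: "y \<in> solutions F"
  shows "transfer s \<Xi> \<Phi> (transfer s \<Phi> \<Xi> y) = y"
proof -
  have "matrix_inv (\<Xi> s) *v (\<Xi> s *v c) = c" for c
    by (simp add: matrix_vector_mul_assoc invertible_matrix_inv[OF assms(4)])
  then show ?thesis
    using solution_eq_fundamental_matrix_mult[OF assms(1-3) y] by (simp add: transfer_def)
qed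

text \<open>
  Corresponding solutions differ by \<open>(\<Xi> t - \<Phi> t) *v c\<close> with \<open>c\<close> fixed, so convergence of the
  difference of the two matrices is all that the correspondence needs.
\<close>
lemma asymptotically_equivalent_if_fundamental_matrices:
  fixes F G \<Phi> \<Xi> :: "real \<Rightarrow> real^'n^'n"
  assumes F: "continuous_on UNIV F" "\<And>t. (\<Phi> has_vector_derivative F t ** \<Phi> t) (at t)"
      "invertible (\<Phi> s)"
    and G: "continuous_on UNIV G" "\<And>t. (\<Xi> has_vector_derivative G t ** \<Xi> t) (at t)"
      "invertible (\<Xi> s)"
    and lim: "((\<lambda>t. \<Xi> t - \<Phi> t) \<longlongrightarrow> 0) at_top"
  shows "asymptotically_equivalent s F G"
  unfolding asymptotically_equivalent_def
proof (intro exI conjI ballI)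
  have "homeomorphic_maps (solution_topology s F) (solution_topology s G)
      (transfer s \<Phi> \<Xi>) (transfer s \<Xi> \<Phi>)"
    unfolding homeomorphic_maps_def
    using continuous_map_transfer[OF F(2)] continuous_map_transfer[OF G(2)]
      transfer_transfer[where \<Phi> = \<Phi> and \<Xi> = \<Xi>, OF F G(3)]
      transfer_transfer[where \<Phi> = \<Xi> and \<Xi> = \<Phi>, OF G F(3)]
    by (auto simp: solution_topology_def topspace_pullback_topology)
  then show "homeomorphic_map (solution_topology s F) (solution_topology s G) (transfer s \<Phi> \<Xi>)"
    using homeomorphic_map_maps by blast
next
  fix y assume "y \<in> solutions F"
  define c where "c = matrix_inv (\<Phi> s) *v y s"
  have y: "y = (\<lambda>t. \<Phi> t *v c)"
    unfolding c_def by (rule solution_eq_fundamental_matrix_mult[OF F \<open>y \<in> solutions F\<close>])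
  have "((\<lambda>t. (\<Xi> t - \<Phi> t) *v c) \<longlongrightarrow> 0 *v c) at_top"
    by (intro bounded_bilinear.tendsto[OF bounded_bilinear_matrix_vector_mult] lim tendsto_const)
  then show "((\<lambda>t. transfer s \<Phi> \<Xi> y t - y t) \<longlongrightarrow> 0) at_top"
    unfolding transfer_def c_def[symmetric] by (subst y) (simp add: matrix_vector_mult_diff_rdistrib)
qed

section \<open>The perturbed system\<close>

theorem theorem2p1:
  fixes A B X P \<Psi> :: "real \<Rightarrow> real^'n^'n" and t0 :: real
  assumes "continuous_on UNIV A" and "continuous_on UNIV B"
    and "\<And>t. (X has_vector_derivative A t ** X t) (at t)" and "X 0 = mat 1"
    and "\<And>t. P t = matrix_inv (X t) ** B t ** X t"
    and "set_integrable lborel {0..} (\<lambda>t. onorm ((*v) (P t)))"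
    and "\<And>t. (\<Psi> has_vector_derivative P t ** (\<Psi> t + mat 1)) (at t)"
    and "(\<Psi> \<longlongrightarrow> 0) at_top"
    and "((\<lambda>t. X t ** \<Psi> t) \<longlongrightarrow> 0) at_top"
  shows "asymptotically_equivalent t0 (\<lambda>t. A t + B t) A"
proof -
  define Y where "Y = (\<lambda>t. X t ** (\<Psi> t + mat 1))"
  have X_inv: "invertible (X t)" for t
  proof (rule matrix_solution_invertible[OF assms(1,3)])
    fix v assume "\<And>t. X t *v v = 0"
    from this[of 0] show "v = 0" by (simp add: assms(4))
  qed
  have AB: "continuous_on UNIV (\<lambda>t. A t + B t)"
    by (intro continuous_on_add assms)
  have Y: "(Y has_vector_derivative (A t + B t) ** Y t) (at t)" for t
  proof -
    have "((\<lambda>t. \<Psi> t + mat 1) has_vector_derivative P t ** (\<Psi> t + mat 1)) (at t)"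
      using has_vector_derivative_add[OF assms(7) has_vector_derivative_const] by simp
    from bounded_bilinear.has_vector_derivative[OF bounded_bilinear_matrix_matrix_mult assms(3) this]
    have "(Y has_vector_derivative
        X t ** (P t ** (\<Psi> t + mat 1)) + A t ** X t ** (\<Psi> t + mat 1)) (at t)"
      by (simp add: Y_def)
    moreover have "X t ** P t = B t ** X t"
      by (simp add: assms(5) matrix_mul_assoc invertible_matrix_inv[OF X_inv])
    ultimately show ?thesis
      by (simp add: Y_def matrix_mul_assoc add.commute
          bounded_bilinear.add_left[OF bounded_bilinear_matrix_matrix_mult])
  qed
  have Y_inv: "invertible (Y t)" for t
  proof (rule matrix_solution_invertible[OF AB Y])
    fix v assume "\<And>t. Y t *v v = 0"
    then have "matrix_inv (X t) *v (X t *v ((\<Psi> t + mat 1) *v v)) = 0" for t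
      by (simp add: Y_def matrix_vector_mul_assoc)
    then have zero: "(\<Psi> t + mat 1) *v v = 0" for t
      by (simp add: matrix_vector_mul_assoc matrix_mul_assoc invertible_matrix_inv[OF X_inv])
    have "((\<lambda>t. (\<Psi> t + mat 1) *v v) \<longlongrightarrow> (0 + mat 1) *v v) at_top"
      by (intro bounded_bilinear.tendsto[OF bounded_bilinear_matrix_vector_mult]
          tendsto_add tendsto_const assms)
    then show "v = 0" by (simp add: zero tendsto_const_iff)
  qed
  have "X t - Y t = - (X t ** \<Psi> t)" for t
    by (simp add: Y_def matrix_add_ldistrib)
  then have "((\<lambda>t. X t - Y t) \<longlongrightarrow> 0) at_top"
    using tendsto_minus[OF assms(9)] by simp
  then show ?thesis
    by (rule asymptotically_equivalent_if_fundamental_matrices[OF AB Y Y_inv assms(1,3) X_inv])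
qed

end
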